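(* Let $N\ge 2$ and $m>N$ be integers. Let $K_{\min}(N,m)$ be the number of distinct values among $\{r_x\}_{x\in\mathcal A(m,N)}$, and let $B(N,m)$ be the number of orbits of $N$-element subsets of $\mathbb Z/m\mathbb Z$ under the dihedral group $D_m$. Then $K_{\min}(N,m)\le B(N,m)$.
   Context: $\mathcal A(m,N):=\{x=(x_1,\dots,x_{N-1})\in\mathbb Z^{N-1}: 0<x_1<\cdots<x_{N-1}<m\}$, with the convention $x_0:=0$. For $x\in\mathcal A(m,N)$, $$r_x:=\prod_{0\le a<b\le N-1}4\sin^2\frac{\pi(x_b-x_a)}{m}.$$ The dihedral group $D_m$ of order $2m$ acts on $\mathbb Z/m\mathbb Z$ by the maps $i\mapsto \varepsilon i+c$ with $\varepsilon\in\{\pm1\}$, $c\in\mathbb Z/m\mathbb Z$, and hence on the set of $N$-element subsets of $\mathbb Z/m\mathbb Z$. *)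

theory Defs
  imports Complex_Main "HOL-Algebra.Group_Action" "HOL-Number_Theory.Residues"
begin

text \<open>
  A tuple \<open>(x\<^sub>1, \<dots>, x\<^bsub>N-1\<^esub>)\<close> is a list of length \<open>N - 1\<close>. Prepending the entry
  \<open>x\<^sub>0 = 0\<close> makes \<open>(0 # x) ! a\<close> the paper's \<open>x\<^sub>a\<close> for \<open>0 \<le> a \<le> N - 1\<close>.
\<close>

definition config :: "nat \<Rightarrow> nat \<Rightarrow> int list set" where
  "config m N = {x. length x = N - 1 \<and> sorted_wrt (<) (0 # x @ [int m])}"

definition r_prod :: "nat \<Rightarrow> nat \<Rightarrow> int list \<Rightarrow> real" where
  "r_prod m N x = (\<Prod>(a, b) \<in> {(a, b). a < b \<and> b \<le> N - 1}.
     4 * (sin (pi * real_of_int ((0 # x) ! b - (0 # x) ! a) / real m))\<^sup>2)"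

definition K_min :: "nat \<Rightarrow> nat \<Rightarrow> nat" where
  "K_min N m = card (r_prod m N ` config m N)"

text \<open>
  \<open>\<int>/m\<int>\<close> is \<open>residue_ring m\<close>, with carrier \<open>{0..m - 1}\<close>. The pair \<open>(\<epsilon>, c)\<close>
  stands for the map \<open>i \<mapsto> \<epsilon> i + c\<close>, and the product is composition of such maps.
\<close>

definition dihedral_group :: "nat \<Rightarrow> (int \<times> int) monoid" where
  "dihedral_group m =
     \<lparr>carrier = {1, -1} \<times> carrier (residue_ring (int m)),
      monoid.mult = (\<lambda>(e, c) (e', c'). (e * e', (e * c' + c) mod int m)),
      one = (1, 0)\<rparr>"

definition dihedral_map :: "nat \<Rightarrow> int \<times> int \<Rightarrow> int \<Rightarrow> int" where
  "dihedral_map m = (\<lambda>(e, c). \<lambda>i \<in> carrier (residue_ring (int m)). (e * i + c) mod int m)"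

definition n_subsets :: "nat \<Rightarrow> nat \<Rightarrow> int set set" where
  "n_subsets N m = {S. S \<subseteq> carrier (residue_ring (int m)) \<and> card S = N}"

definition dihedral_set_map :: "nat \<Rightarrow> nat \<Rightarrow> int \<times> int \<Rightarrow> int set \<Rightarrow> int set" where
  "dihedral_set_map N m g = (\<lambda>S \<in> n_subsets N m. dihedral_map m g ` S)"

definition B_orbits :: "nat \<Rightarrow> nat \<Rightarrow> nat" where
  "B_orbits N m = card (orbits (dihedral_group m) (n_subsets N m) (dihedral_set_map N m))"

lemma config_iff:
  "x \<in> config m N \<longleftrightarrow> length x = N - 1 \<and> sorted_wrt (<) x \<and> (\<forall>y \<in> set x. 0 < y \<and> y < int m)
     \<and> 0 < m"
  by (auto simp: config_def sorted_wrt_append)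

lemma carrier_residue_ring: "carrier (residue_ring (int m)) = {0..<int m}"
  by (auto simp: residue_ring_def)

lemma dihedral_map_closed:
  assumes "0 < m" shows "dihedral_map m g \<in> {0..<int m} \<rightarrow> {0..<int m}"
  using assms by (cases g) (auto simp: dihedral_map_def carrier_residue_ring)

lemma dihedral_map_mult:
  assumes "0 < m" "i \<in> {0..<int m}"
  shows "dihedral_map m (g \<otimes>\<^bsub>dihedral_group m\<^esub> h) i = dihedral_map m g (dihedral_map m h i)"
proof -
  obtain e c where g: "g = (e, c)" by (cases g)
  obtain e' c' where h: "h = (e', c')" by (cases h)
  have "(e * e' * i + (e * c' + c) mod int m) mod int m = (e * e' * i + (e * c' + c)) mod int m"
    by (simp add: mod_simps)
  also have "\<dots> = (e * (e' * i + c') + c) mod int m"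
    by (simp add: algebra_simps)
  also have "\<dots> = (e * ((e' * i + c') mod int m) + c) mod int m"
    by (metis mod_add_left_eq mod_mult_right_eq)
  finally show ?thesis
    using assms by (simp add: g h dihedral_map_def dihedral_group_def carrier_residue_ring)
qed

lemma dihedral_map_one:
  "i \<in> {0..<int m} \<Longrightarrow> dihedral_map m \<one>\<^bsub>dihedral_group m\<^esub> i = i"
  by (simp add: dihedral_map_def dihedral_group_def carrier_residue_ring)

lemma group_dihedral_group:
  assumes "0 < m" shows "group (dihedral_group m)"
proof (rule groupI)
  fix x y z
  assume "x \<in> carrier (dihedral_group m)" "y \<in> carrier (dihedral_group m)"
    "z \<in> carrier (dihedral_group m)"
  then show "x \<otimes>\<^bsub>dihedral_group m\<^esub> y \<otimes>\<^bsub>dihedral_group m\<^esub> z =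
    x \<otimes>\<^bsub>dihedral_group m\<^esub> (y \<otimes>\<^bsub>dihedral_group m\<^esub> z)"
    by (auto simp: dihedral_group_def mod_simps algebra_simps split: prod.splits)
next
  fix x assume x: "x \<in> carrier (dihedral_group m)"
  obtain e c where ec: "x = (e, c)" by (cases x)
  have "e * e = 1" using x by (auto simp: dihedral_group_def ec)
  then have "(e, (- (e * c)) mod int m) \<otimes>\<^bsub>dihedral_group m\<^esub> x = \<one>\<^bsub>dihedral_group m\<^esub>"
    by (simp add: dihedral_group_def ec mod_simps)
  moreover have "(e, (- (e * c)) mod int m) \<in> carrier (dihedral_group m)"
    using x assms by (auto simp: dihedral_group_def ec carrier_residue_ring)
  ultimately show "\<exists>y \<in> carrier (dihedral_group m).
      y \<otimes>\<^bsub>dihedral_group m\<^esub> x = \<one>\<^bsub>dihedral_group m\<^esub>" by blast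
qed (use assms in \<open>auto simp: dihedral_group_def carrier_residue_ring\<close>)

lemma order_dihedral_group: "order (dihedral_group m) = 2 * m"
  by (simp add: order_def dihedral_group_def carrier_residue_ring card_cartesian_product)

lemma dihedral_map_bij:
  assumes m: "0 < m" and g: "g \<in> carrier (dihedral_group m)"
  shows "bij_betw (dihedral_map m g) {0..<int m} {0..<int m}"
proof -
  interpret group "dihedral_group m" by (rule group_dihedral_group[OF m])
  show ?thesis
  proof (rule bij_betw_byWitness[where f' = "dihedral_map m (inv\<^bsub>dihedral_group m\<^esub> g)"])
    show "\<forall>i \<in> {0..<int m}. dihedral_map m (inv\<^bsub>dihedral_group m\<^esub> g) (dihedral_map m g i) = i"
      using g m by (simp add: dihedral_map_mult[symmetric] dihedral_map_one del: atLeastLessThan_iff)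
    show "\<forall>i \<in> {0..<int m}. dihedral_map m g (dihedral_map m (inv\<^bsub>dihedral_group m\<^esub> g) i) = i"
      using g m by (simp add: dihedral_map_mult[symmetric] dihedral_map_one del: atLeastLessThan_iff)
    show "dihedral_map m g ` {0..<int m} \<subseteq> {0..<int m}"
      by (rule funcset_image[OF dihedral_map_closed[OF m]])
    show "dihedral_map m (inv\<^bsub>dihedral_group m\<^esub> g) ` {0..<int m} \<subseteq> {0..<int m}"
      by (rule funcset_image[OF dihedral_map_closed[OF m]])
  qed
qed

lemma dihedral_set_map_closed:
  assumes m: "0 < m" and g: "g \<in> carrier (dihedral_group m)" and S: "S \<in> n_subsets N m"
  shows "dihedral_set_map N m g S \<in> n_subsets N m"
proof -
  have sub: "S \<subseteq> {0..<int m}" using S by (simp add: n_subsets_def carrier_residue_ring)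
  have "inj_on (dihedral_map m g) S"
    using dihedral_map_bij[OF m g] sub by (meson bij_betw_def inj_on_subset)
  moreover have "dihedral_map m g ` S \<subseteq> {0..<int m}"
    using dihedral_map_closed[OF m] sub by blast
  ultimately show ?thesis
    using S by (simp add: dihedral_set_map_def n_subsets_def carrier_residue_ring card_image)
qed

lemma dihedral_set_map_mult:
  assumes m: "0 < m" and h: "h \<in> carrier (dihedral_group m)" and S: "S \<in> n_subsets N m"
  shows "dihedral_set_map N m (g \<otimes>\<^bsub>dihedral_group m\<^esub> h) S =
    dihedral_set_map N m g (dihedral_set_map N m h S)"
proof -
  have sub: "S \<subseteq> {0..<int m}" using S by (simp add: n_subsets_def carrier_residue_ring)
  have cl: "dihedral_map m h ` S \<in> n_subsets N m"
    using dihedral_set_map_closed[OF m h S] S by (simp add: dihedral_set_map_def)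
  have "dihedral_map m (g \<otimes>\<^bsub>dihedral_group m\<^esub> h) ` S = dihedral_map m g ` dihedral_map m h ` S"
    unfolding image_image using sub m by (intro image_cong) (auto simp: dihedral_map_mult)
  then show ?thesis using S cl by (simp add: dihedral_set_map_def)
qed

lemma dihedral_set_map_one:
  assumes S: "S \<in> n_subsets N m"
  shows "dihedral_set_map N m \<one>\<^bsub>dihedral_group m\<^esub> S = S"
proof -
  have "S \<subseteq> {0..<int m}" using S by (simp add: n_subsets_def carrier_residue_ring)
  then have "dihedral_map m \<one>\<^bsub>dihedral_group m\<^esub> ` S = (\<lambda>i. i) ` S"
    by (intro image_cong) (auto simp: dihedral_map_one)
  then show ?thesis using S by (simp add: dihedral_set_map_def)
qed

lemma group_action_dihedral:
  assumes m: "0 < m"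
  shows "group_action (dihedral_group m) (n_subsets N m) (dihedral_set_map N m)"
proof -
  interpret group "dihedral_group m" by (rule group_dihedral_group[OF m])
  let ?D = "dihedral_group m" and ?E = "n_subsets N m" and ?f = "dihedral_set_map N m"
  have Bij: "?f g \<in> Bij ?E" if g: "g \<in> carrier ?D" for g
  proof -
    have "bij_betw (?f g) ?E ?E"
    proof (rule bij_betw_byWitness[where f' = "?f (inv\<^bsub>?D\<^esub> g)"])
      show "\<forall>S \<in> ?E. ?f (inv\<^bsub>?D\<^esub> g) (?f g S) = S"
        using g m by (simp add: dihedral_set_map_mult[symmetric] dihedral_set_map_one)
      show "\<forall>S \<in> ?E. ?f g (?f (inv\<^bsub>?D\<^esub> g) S) = S"
        using g m by (simp add: dihedral_set_map_mult[symmetric] dihedral_set_map_one)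
    qed (use dihedral_set_map_closed[OF m g] dihedral_set_map_closed[OF m inv_closed[OF g]] in auto)
    then show ?thesis by (simp add: Bij_def dihedral_set_map_def)
  qed
  have "?f (g \<otimes>\<^bsub>?D\<^esub> h) = compose ?E (?f g) (?f h)"
    if "g \<in> carrier ?D" "h \<in> carrier ?D" for g h
  proof (rule extensionalityI[of _ ?E])
    show "?f (g \<otimes>\<^bsub>?D\<^esub> h) \<in> extensional ?E" by (simp add: dihedral_set_map_def)
    fix S assume "S \<in> ?E"
    then show "?f (g \<otimes>\<^bsub>?D\<^esub> h) S = compose ?E (?f g) (?f h) S"
      using that m by (simp add: dihedral_set_map_mult compose_def)
  qed (simp add: compose_extensional)
  with Bij have "?f \<in> hom ?D (BijGroup ?E)"
    by (auto simp: hom_def BijGroup_def)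
  then show ?thesis
    by (simp add: group_action_def group_hom_def group_hom_axioms_def group_BijGroup
        is_group)
qed

end

theory Submission
  imports Defs
begin

text \<open>
  The product over unordered pairs of \<open>4 sin\<^sup>2\<close> equals the product over ordered pairs of distinct
  elements of the chord length \<open>2 \<bar>sin\<bar>\<close>, and the latter depends only on the set of points.
  Dihedral maps are injective and preserve chord lengths, so the product is constant on orbits.
  As every configuration, completed by the point \<open>0\<close>, is an \<open>N\<close>-subset, there are at most as many
  values as orbits.
\<close>

text \<open>This is the distance between the points of the unit circle at angles
  \<open>2 * pi * i / m\<close> and \<open>2 * pi * j / m\<close>. The absolute value discards the
  sign that \<open>sin\<close> picks up under shifts by \<open>pi\<close>.\<close>

definition chord :: "nat \<Rightarrow> int \<Rightarrow> int \<Rightarrow> real" where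
  "chord m i j = 2 * \<bar>sin (pi * real_of_int (i - j) / real m)\<bar>"

definition chord_prod :: "nat \<Rightarrow> int set \<Rightarrow> real" where
  "chord_prod m S = (\<Prod>(i, j) \<in> {(i, j) \<in> S \<times> S. i \<noteq> j}. chord m i j)"

text \<open>Distinctness turns pairs of different entries into pairs of different indices. These
  split into \<open>a < b\<close> and \<open>b < a\<close>; by symmetry both halves give the same
  product, hence the square.\<close>

lemma prod_offdiag_distinct_list:
  fixes f :: "'a \<Rightarrow> 'a \<Rightarrow> 'b::comm_monoid_mult"
  assumes xs: "distinct xs" and sym: "\<And>x y. f x y = f y x"
  shows "(\<Prod>(x, y) \<in> {(x, y) \<in> set xs \<times> set xs. x \<noteq> y}. f x y) =
    (\<Prod>(a, b) \<in> {(a, b). a < b \<and> b < length xs}. (f (xs ! a) (xs ! b))\<^sup>2)"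
proof -
  let ?n = "length xs"
  let ?L = "{(a, b). a < b \<and> b < ?n}" and ?U = "{(a, b). b < a \<and> a < ?n}"
  let ?g = "\<lambda>(a, b). f (xs ! a) (xs ! b)"
  have fin: "finite ?L" "finite ?U"
    by (rule finite_subset[of _ "{..<?n} \<times> {..<?n}"]; auto)+
  have inj: "inj_on (map_prod ((!) xs) ((!) xs)) (?L \<union> ?U)"
    using xs by (auto simp: inj_on_def nth_eq_iff_index_eq)
  have img: "map_prod ((!) xs) ((!) xs) ` (?L \<union> ?U) = {(x, y) \<in> set xs \<times> set xs. x \<noteq> y}"
  proof (intro equalityI subsetI)
    fix p assume "p \<in> {(x, y) \<in> set xs \<times> set xs. x \<noteq> y}"
    then obtain a b where "a < ?n" "b < ?n" "xs ! a \<noteq> xs ! b" "p = (xs ! a, xs ! b)"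
      by (auto simp: in_set_conv_nth)
    moreover from this have "(a, b) \<in> ?L \<union> ?U" by (cases a b rule: linorder_cases) auto
    ultimately show "p \<in> map_prod ((!) xs) ((!) xs) ` (?L \<union> ?U)"
      by (intro image_eqI[where x = "(a, b)"]) simp_all
  qed (use xs in \<open>auto simp: nth_eq_iff_index_eq\<close>)
  have "(\<Prod>(x, y) \<in> {(x, y) \<in> set xs \<times> set xs. x \<noteq> y}. f x y) = prod ?g (?L \<union> ?U)"
    unfolding img[symmetric] using prod.reindex[OF inj, of "\<lambda>(x, y). f x y"]
    by (simp add: comp_def case_prod_unfold)
  also have "\<dots> = prod ?g ?L * prod ?g ?U"
    using fin by (intro prod.union_disjoint) auto
  also have "prod ?g ?U = prod ?g ?L"
    by (rule prod.reindex_bij_witness[of _ "\<lambda>(a, b). (b, a)" "\<lambda>(a, b). (b, a)"])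
      (auto intro: sym)
  finally show ?thesis
    by (simp add: power2_eq_square case_prod_unfold flip: prod.distrib)
qed

lemma chord_commute: "chord m i j = chord m j i"
proof -
  have "pi * real_of_int (i - j) / real m = - (pi * real_of_int (j - i) / real m)"
    by (simp add: diff_divide_distrib right_diff_distrib)
  then show ?thesis by (simp add: chord_def)
qed

lemma chord_square:
  "(chord m i j)\<^sup>2 = 4 * (sin (pi * real_of_int (j - i) / real m))\<^sup>2"
  by (simp add: chord_commute[of m i j]) (simp add: chord_def power_mult_distrib)

lemma abs_sin_add_int_pi: "\<bar>sin (x + pi * real_of_int k)\<bar> = \<bar>sin x\<bar>"
  using sin_npi_int[of k] cos_npi_int[of k] by (simp add: sin_add abs_mult)

text \<open>A change of the difference by \<open>m * k\<close> shifts the argument of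
  \<open>sin\<close> by \<open>pi * k\<close>, which affects only the sign.\<close>

lemma chord_cong:
  assumes "0 < m" and "[i - j = i' - j'] (mod int m)"
  shows "chord m i j = chord m i' j'"
proof -
  obtain k where "i - j = (i' - j') + int m * k"
    using assms(2) by (metis cong_iff_lin cong_sym mult.commute)
  then have "pi * real_of_int (i - j) / real m = pi * real_of_int (i' - j') / real m + pi * real_of_int k"
    using assms(1) by (simp add: distrib_left add_divide_distrib del: of_int_diff)
  then show ?thesis by (simp only: chord_def abs_sin_add_int_pi)
qed

text \<open>The translation cancels in the difference, reduction modulo \<open>m\<close> is harmless
  by \<open>chord_cong\<close>, and the sign \<open>-1\<close> merely swaps the two end
  points.\<close>

lemma chord_dihedral_map:
  assumes m: "0 < m" and g: "g \<in> carrier (dihedral_group m)"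
    and ij: "i \<in> {0..<int m}" "j \<in> {0..<int m}"
  shows "chord m (dihedral_map m g i) (dihedral_map m g j) = chord m i j"
proof -
  obtain e c where ec: "g = (e, c)" by (cases g)
  have "[(e * i + c) mod int m - (e * j + c) mod int m = e * i - e * j] (mod int m)"
    by (simp add: cong_def mod_simps)
  then have "chord m (dihedral_map m g i) (dihedral_map m g j) = chord m (e * i) (e * j)"
    using ij by (intro chord_cong[OF m]) (simp add: dihedral_map_def ec carrier_residue_ring)
  moreover have "e = 1 \<or> e = -1" using g by (auto simp: dihedral_group_def ec)
  moreover have "chord m (- i) (- j) = chord m j i" by (simp add: chord_def)
  ultimately show ?thesis by (auto simp: chord_commute)
qed

lemma chord_prod_dihedral_set_map:
  assumes m: "0 < m" and g: "g \<in> carrier (dihedral_group m)" and S: "S \<in> n_subsets N m"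
  shows "chord_prod m (dihedral_set_map N m g S) = chord_prod m S"
proof -
  let ?d = "dihedral_map m g"
  let ?A = "{(i, j) \<in> S \<times> S. i \<noteq> j}"
  have sub: "S \<subseteq> {0..<int m}" using S by (simp add: n_subsets_def carrier_residue_ring)
  have inj: "inj_on ?d S"
    using dihedral_map_bij[OF m g] sub by (meson bij_betw_def inj_on_subset)
  then have inj': "inj_on (map_prod ?d ?d) ?A" by (auto simp: inj_on_def)
  have img: "{(i, j) \<in> ?d ` S \<times> ?d ` S. i \<noteq> j} = map_prod ?d ?d ` ?A"
    using inj by (force simp: inj_on_def)
  have "chord_prod m (?d ` S) = (\<Prod>(i, j) \<in> ?A. chord m (?d i) (?d j))"
    unfolding chord_prod_def img using prod.reindex[OF inj', of "\<lambda>(i, j). chord m i j"]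
    by (simp add: comp_def case_prod_unfold)
  also have "\<dots> = chord_prod m S"
    unfolding chord_prod_def using sub
    by (intro prod.cong) (auto intro!: chord_dihedral_map[OF m g] simp del: atLeastLessThan_iff)
  finally show ?thesis using S by (simp add: dihedral_set_map_def)
qed

lemma r_prod_eq_chord_prod:
  assumes "distinct (0 # x)" and "length x = N - 1"
  shows "r_prod m N x = chord_prod m (set (0 # x))"
proof -
  \<comment> \<open>Prepending \<open>0\<close> adds one to the length, so the bounds
    \<open>N - 1\<close> and \<open>length (0 # x)\<close> describe the same indices.\<close>
  have "{(a, b). a < b \<and> b \<le> N - 1} = {(a, b). a < b \<and> b < length (0 # x)}"
    using assms(2) by auto
  then show ?thesis
    unfolding r_prod_def chord_prod_def
      prod_offdiag_distinct_list[where f = "chord m", OF assms(1) chord_commute]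
    by (simp only: chord_square)
qed

lemma config_distinct: "x \<in> config m N \<Longrightarrow> distinct (0 # x)"
  by (auto simp: config_iff strict_sorted_iff)

text \<open>With \<open>0 < N\<close>, truncated subtraction does no harm: the \<open>N - 1\<close>
  entries and the extra point \<open>0\<close> make \<open>N\<close> distinct residues.\<close>

lemma config_in_n_subsets:
  assumes "x \<in> config m N" and "0 < N"
  shows "set (0 # x) \<in> n_subsets N m"
  using assms distinct_card[OF config_distinct[OF assms(1)]]
  by (auto simp: config_iff n_subsets_def carrier_residue_ring less_imp_le)

theorem corollary5p4:
  fixes N m :: nat
  assumes "N \<ge> 2" and "m > N"
  shows "K_min N m \<le> B_orbits N m"
proof -
  let ?orb = "orbit (dihedral_group m) (dihedral_set_map N m)"
  let ?Orbs = "orbits (dihedral_group m) (n_subsets N m) (dihedral_set_map N m)"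
  \<comment> \<open>The value of an orbit is read off an arbitrary representative; fact
    \<open>F\<close> shows that the choice does not matter.\<close>
  let ?F = "\<lambda>Q. chord_prod m (SOME S. S \<in> Q)"
  have m: "0 < m" using assms by simp
  interpret group_action "dihedral_group m" "n_subsets N m" "dihedral_set_map N m"
    by (rule group_action_dihedral[OF m])
  have F: "?F (?orb S) = chord_prod m S" if S: "S \<in> n_subsets N m" for S
  proof -
    have "S \<in> ?orb S" using S by (rule orbit_refl)
    then have "(SOME T. T \<in> ?orb S) \<in> ?orb S" by (rule someI)
    then show ?thesis using chord_prod_dihedral_set_map[OF m _ S] by (auto simp: orbit_def)
  qed
  have "finite (n_subsets N m)"
    by (rule finite_subset[of _ "Pow {0..<int m}"]) (auto simp: n_subsets_def carrier_residue_ring)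
  \<comment> \<open>Finiteness is essential here, since \<open>card\<close> of an infinite set would
    be \<open>0\<close>.\<close>
  then have fin: "finite ?Orbs" by (simp add: orbits_def)
  have "r_prod m N ` config m N \<subseteq> ?F ` ?Orbs"
  proof
    fix r assume "r \<in> r_prod m N ` config m N"
    then obtain x where x: "x \<in> config m N" and r: "r = r_prod m N x" by blast
    have S: "set (0 # x) \<in> n_subsets N m" using x assms by (intro config_in_n_subsets) auto
    have "r = ?F (?orb (set (0 # x)))"
      unfolding F[OF S] r using x by (intro r_prod_eq_chord_prod config_distinct) (auto simp: config_iff)
    then show "r \<in> ?F ` ?Orbs" using S by (auto simp: orbits_def)
  qed
  then show ?thesis
    unfolding K_min_def B_orbits_def by (rule surj_card_le[OF fin])
qed

end
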